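(* Let $\mathbf E$ be an $n$-dimensional nilpotent evolution algebra of maximal nilindex in the normal form given in the context. Let $R\in\mathrm{RB}_0(\mathbf E)$ have nonzero threshold $k$. Then for every interior tail vertex $i\in\{k+1,\dots,n-1\}$, every derivation $D\in\mathrm{Der}(\mathbf E)$, and every automorphism $\phi\in\mathrm{Aut}(\mathbf E)$, one has $$[R,D](\mathbf e_i)=0,\qquad [R,\phi](\mathbf e_i)=0.$$ Consequently, the commutation problem is decided entirely by the equations at the pre-threshold vertices $i<k$ and at the threshold vertex $i=k$; that is, $[R,D]=0$ if and only if $[R,D](\mathbf e_i)=0$ for all $1\le i\le k$, and $[R,\phi]=0$ if and only if $[R,\phi](\mathbf e_i)=0$ for all $1\le i\le k$.
   Context: $\mathbb K$ is a field of characteristic zero and $n\ge 3$. An evolution algebra is an algebra with a basis $\{\mathbf e_1,\dots,\mathbf e_n\}$ (a natural basis) such that $\mathbf e_i\mathbf e_j=0$ for $i\ne j$. Every $n$-dimensional nilpotent evolution algebra of maximal nilindex over $\mathbb K$ admits a natural basis with $$\mathbf e_i^2=\mathbf e_{i+1}+\sum_{j=i+2}^{n-1}a_{ij}\mathbf e_j\ (1\le i\le n-3),\quad \mathbf e_{n-2}^2=\mathbf e_{n-1},\quad \mathbf e_{n-1}^2=\mathbf e_n,\quad \mathbf e_n^2=0,$$ with $a_{ij}\in\mathbb K$; $\mathbf E$ denotes such an algebra with this fixed basis (the normal form). Put $\mathcal I_A=\{(i,j): i+1<j<n,\ a_{ij}\ne0\}$, and define $i_0=0$ if $\mathcal I_A=\varnothing$,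 and $i_0=\max\{i:(i,j)\in\mathcal I_A\text{ for some }j\}$ otherwise. The vertices are those of the directed graph on $\{1,\dots,n\}$ with an edge $i\to j$ whenever the coefficient of $\mathbf e_j$ in $\mathbf e_i^2$ is nonzero; vertex $i$ corresponds to the basis vector $\mathbf e_i$. $\mathrm{RB}_0(\mathbf E)$ is the set of linear maps $R:\mathbf E\to\mathbf E$ with $R(x)R(y)=R(R(x)y+xR(y))$ for all $x,y\in\mathbf E$. It is known that each $R\in\mathrm{RB}_0(\mathbf E)$ either has image in $\mathbb K\mathbf e_n$, or has nonzero threshold $k$, meaning: there are $k\in\{i_0+1,\dots,n-1\}$, $\lambda\in\mathbb K\setminus\{0\}$ and $\beta_1,\dots,\beta_k\in\mathbb K$ with $R(\mathbf e_i)=\beta_i\mathbf e_n$ for $1\le i<k$, $R(\mathbf e_k)=2^{n-k}\lambda\mathbf e_k+\beta_k\mathbf e_n$, and $R(\mathbf e_i)=2^{n-i}\lambda\mathbf e_i$ for $k<i\le n$. $\mathrm{Der}(\mathbf E)$ is the space of derivations and $\mathrm{Aut}(\mathbf E)$ the group of algebra automorphisms of $\mathbf E$. The commutator is $[S,T]=ST-TS$. *)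

theory Defs
  imports Complex_Main
begin

text \<open>
  The algebra lives on a whole type \<open>'v\<close>, with \<open>scale\<close> the action of the field and \<open>mult\<close> a
  product that is neither assumed associative nor commutative. A basis
  \<open>e\<^sub>1, \<dots>, e\<^sub>n\<close> is a function \<open>e :: nat \<Rightarrow> 'v\<close> of which only the values on \<open>{1..n}\<close> matter.
\<close>

definition algebra_over ::
  "('k::field \<Rightarrow> 'v::ab_group_add \<Rightarrow> 'v) \<Rightarrow> ('v \<Rightarrow> 'v \<Rightarrow> 'v) \<Rightarrow> bool" where
  "algebra_over scale mult \<longleftrightarrow>
     vector_space scale \<and>
     (\<forall>x. Vector_Spaces.linear scale scale (\<lambda>y. mult x y)) \<and>
     (\<forall>y. Vector_Spaces.linear scale scale (\<lambda>x. mult x y))"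

definition natural_basis ::
  "('k::field \<Rightarrow> 'v::ab_group_add \<Rightarrow> 'v) \<Rightarrow> ('v \<Rightarrow> 'v \<Rightarrow> 'v) \<Rightarrow> nat \<Rightarrow> (nat \<Rightarrow> 'v) \<Rightarrow> bool" where
  "natural_basis scale mult n e \<longleftrightarrow>
     inj_on e {1..n} \<and>
     \<not> module.dependent scale (e ` {1..n}) \<and>
     module.span scale (e ` {1..n}) = UNIV \<and>
     (\<forall>i\<in>{1..n}. \<forall>j\<in>{1..n}. i \<noteq> j \<longrightarrow> mult (e i) (e j) = 0)"

definition evolution_algebra ::
  "('k::field \<Rightarrow> 'v::ab_group_add \<Rightarrow> 'v) \<Rightarrow> ('v \<Rightarrow> 'v \<Rightarrow> 'v) \<Rightarrow> nat \<Rightarrow> bool" where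
  "evolution_algebra scale mult n \<longleftrightarrow>
     algebra_over scale mult \<and> (\<exists>e. natural_basis scale mult n e)"

text \<open>
  \<open>E\<^sup>1 = E\<close> and \<open>E\<^sup>m\<close> is the sum of the products \<open>E\<^sup>i E\<^sup>m\<^sup>-\<^sup>i\<close> over \<open>1 \<le> i < m\<close>. The value at \<open>m = 0\<close>
  is a dummy.
\<close>

fun alg_power ::
  "('k::field \<Rightarrow> 'v::ab_group_add \<Rightarrow> 'v) \<Rightarrow> ('v \<Rightarrow> 'v \<Rightarrow> 'v) \<Rightarrow> nat \<Rightarrow> 'v set" where
  "alg_power scale mult m =
     (if m \<le> 1 then UNIV
      else module.span scale
             (\<Union>i\<in>{1..<m}. {z. \<exists>x \<in> alg_power scale mult i.
                               \<exists>y \<in> alg_power scale mult (m - i). z = mult x y}))"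

declare alg_power.simps [simp del]

definition nilpotent_algebra ::
  "('k::field \<Rightarrow> 'v::ab_group_add \<Rightarrow> 'v) \<Rightarrow> ('v \<Rightarrow> 'v \<Rightarrow> 'v) \<Rightarrow> bool" where
  "nilpotent_algebra scale mult \<longleftrightarrow> (\<exists>m\<ge>1. alg_power scale mult m = {0})"

definition nilindex ::
  "('k::field \<Rightarrow> 'v::ab_group_add \<Rightarrow> 'v) \<Rightarrow> ('v \<Rightarrow> 'v \<Rightarrow> 'v) \<Rightarrow> nat" where
  "nilindex scale mult = (LEAST m. m \<ge> 1 \<and> alg_power scale mult m = {0})"

text \<open>
  Every \<open>n\<close>-dimensional algebra is isomorphic to one on the given \<open>n\<close>-dimensional vector space, so
  it suffices to compare with the other products on that space. The maximum is \<open>2\<^sup>n\<^sup>-\<^sup>1 + 1\<close>.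
\<close>

definition nilpotent_evolution_algebra_max_nilindex ::
  "('k::field \<Rightarrow> 'v::ab_group_add \<Rightarrow> 'v) \<Rightarrow> ('v \<Rightarrow> 'v \<Rightarrow> 'v) \<Rightarrow> nat \<Rightarrow> bool" where
  "nilpotent_evolution_algebra_max_nilindex scale mult n \<longleftrightarrow>
     evolution_algebra scale mult n \<and> nilpotent_algebra scale mult \<and>
     (\<forall>mult'. evolution_algebra scale mult' n \<and> nilpotent_algebra scale mult'
        \<longrightarrow> nilindex scale mult' \<le> nilindex scale mult)"

text \<open>Only the entries \<open>a i j\<close> with \<open>1 \<le> i\<close> and \<open>i + 1 < j < n\<close> are structure constants.\<close>

definition normal_form ::
  "('k::field \<Rightarrow> 'v::ab_group_add \<Rightarrow> 'v) \<Rightarrow> ('v \<Rightarrow> 'v \<Rightarrow> 'v) \<Rightarrow> nat \<Rightarrow> (nat \<Rightarrow> 'v)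
     \<Rightarrow> (nat \<Rightarrow> nat \<Rightarrow> 'k) \<Rightarrow> bool" where
  "normal_form scale mult n e a \<longleftrightarrow>
     natural_basis scale mult n e \<and>
     (\<forall>i\<in>{1..n-3}. mult (e i) (e i) = e (i+1) + (\<Sum>j\<in>{i+2..n-1}. scale (a i j) (e j))) \<and>
     mult (e (n-2)) (e (n-2)) = e (n-1) \<and>
     mult (e (n-1)) (e (n-1)) = e n \<and>
     mult (e n) (e n) = 0"

definition index_set :: "nat \<Rightarrow> (nat \<Rightarrow> nat \<Rightarrow> 'k::zero) \<Rightarrow> (nat \<times> nat) set" where
  "index_set n a = {(i, j). 1 \<le> i \<and> i + 1 < j \<and> j < n \<and> a i j \<noteq> 0}"

definition i0 :: "nat \<Rightarrow> (nat \<Rightarrow> nat \<Rightarrow> 'k::zero) \<Rightarrow> nat" where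
  "i0 n a = (if index_set n a = {} then 0 else Max {i. \<exists>j. (i, j) \<in> index_set n a})"

definition RB0 ::
  "('k::field \<Rightarrow> 'v::ab_group_add \<Rightarrow> 'v) \<Rightarrow> ('v \<Rightarrow> 'v \<Rightarrow> 'v) \<Rightarrow> ('v \<Rightarrow> 'v) set" where
  "RB0 scale mult =
     {R. Vector_Spaces.linear scale scale R \<and>
         (\<forall>x y. mult (R x) (R y) = R (mult (R x) y + mult x (R y)))}"

definition nonzero_threshold ::
  "('k::field \<Rightarrow> 'v::ab_group_add \<Rightarrow> 'v) \<Rightarrow> nat \<Rightarrow> (nat \<Rightarrow> 'v) \<Rightarrow> (nat \<Rightarrow> nat \<Rightarrow> 'k)
     \<Rightarrow> ('v \<Rightarrow> 'v) \<Rightarrow> nat \<Rightarrow> bool" where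
  "nonzero_threshold scale n e a R k \<longleftrightarrow>
     k \<in> {i0 n a + 1..n-1} \<and>
     (\<exists>l \<beta>. l \<noteq> 0 \<and>
        (\<forall>i. 1 \<le> i \<and> i < k \<longrightarrow> R (e i) = scale (\<beta> i) (e n)) \<and>
        R (e k) = scale (2^(n-k) * l) (e k) + scale (\<beta> k) (e n) \<and>
        (\<forall>i. k < i \<and> i \<le> n \<longrightarrow> R (e i) = scale (2^(n-i) * l) (e i)))"

definition Der ::
  "('k::field \<Rightarrow> 'v::ab_group_add \<Rightarrow> 'v) \<Rightarrow> ('v \<Rightarrow> 'v \<Rightarrow> 'v) \<Rightarrow> ('v \<Rightarrow> 'v) set" where
  "Der scale mult =
     {D. Vector_Spaces.linear scale scale D \<and>
         (\<forall>x y. D (mult x y) = mult (D x) y + mult x (D y))}"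

definition Aut ::
  "('k::field \<Rightarrow> 'v::ab_group_add \<Rightarrow> 'v) \<Rightarrow> ('v \<Rightarrow> 'v \<Rightarrow> 'v) \<Rightarrow> ('v \<Rightarrow> 'v) set" where
  "Aut scale mult =
     {\<phi>. Vector_Spaces.linear scale scale \<phi> \<and> bij \<phi> \<and>
         (\<forall>x y. \<phi> (mult x y) = mult (\<phi> x) (\<phi> y))}"

definition commutator :: "('v \<Rightarrow> 'v) \<Rightarrow> ('v \<Rightarrow> 'v) \<Rightarrow> 'v \<Rightarrow> 'v::ab_group_add" where
  "commutator S T = (\<lambda>x. S (T x) - T (S x))"

end

theory Submission imports Defs begin

text \<open>
  Every tail vector is a square: above the index \<open>i0\<close> the normal form degenerates to
  \<open>e\<^sub>i\<^sup>2 = e\<^sub>i\<^sub>+\<^sub>1\<close>, so for \<open>i > k\<close> the vector \<open>e\<^sub>i\<close> is the square of \<open>e\<^sub>i\<^sub>-\<^sub>1\<close>. Squares of basis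
  vectors are common eigenvectors of all derivations and all automorphisms, and by the threshold
  form of \<open>R\<close> the tail vectors are eigenvectors of \<open>R\<close> as well. Two maps commute on a common
  eigenvector, which gives the vanishing of both commutators on the tail; since this includes
  \<open>e\<^sub>n\<close>, a commutator, being linear, is zero as soon as it vanishes on \<open>e\<^sub>1, \<dots>, e\<^sub>k\<close>.

  That \<open>e\<^sub>i\<^sup>2\<close> is an eigenvector is immediate for a derivation \<open>D\<close>, because multiplication by \<open>e\<^sub>i\<close>
  sees only the \<open>i\<close>-th coordinate of \<open>D e\<^sub>i\<close> (\<open>derivation_square\<close>). For an automorphism \<open>\<phi>\<close> the
  matrix has to be diagonal apart from its last column. Since \<open>e\<^sub>i\<^sup>2\<close> equals \<open>e\<^sub>i\<^sub>+\<^sub>1\<close> plus a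
  combination of later basis vectors, the leading term of a square determines the leading term of
  the vector, and descending induction shows that \<open>\<phi>\<close> is triangular with nonzero diagonal
  (\<open>endomorphism_triangular\<close>, \<open>endomorphism_diagonal\<close>). The relations
  \<open>\<phi>(e\<^sub>i) \<phi>(e\<^sub>j) = 0\<close> for \<open>i \<noteq> j\<close> then remove all entries off the diagonal except those
  at \<open>e\<^sub>n\<close> (\<open>endomorphism_off_diagonal\<close>), and these are lost on squaring because \<open>e\<^sub>n\<close> annihilates
  the algebra (\<open>endomorphism_square\<close>).
\<close>

section \<open>Coordinates in a chain evolution algebra\<close>

text \<open>
  The only feature of the normal form that controls endomorphisms is the leading term of each
  square, so the terms after it stay unspecified here.
\<close>

locale chain_evolution_algebra = vector_space scale
  for scale :: "'k::field \<Rightarrow> 'v::ab_group_add \<Rightarrow> 'v" +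
  fixes mult :: "'v \<Rightarrow> 'v \<Rightarrow> 'v" and n :: nat and e :: "nat \<Rightarrow> 'v"
  assumes linear_right: "Vector_Spaces.linear scale scale (\<lambda>y. mult x y)"
    and linear_left: "Vector_Spaces.linear scale scale (\<lambda>x. mult x y)"
    and n_pos: "1 \<le> n"
    and natural: "natural_basis scale mult n e"
    and square_leading:
      "\<lbrakk>1 \<le> i; i < n\<rbrakk> \<Longrightarrow> mult (e i) (e i) - e (Suc i) \<in> span (e ` {i+2..n})"
    and square_last: "mult (e n) (e n) = 0"
begin

lemmas linear_add = module_hom.add[OF Vector_Spaces.linear.axioms(3)]
lemmas linear_scale = module_hom.scale[OF Vector_Spaces.linear.axioms(3)]
lemmas linear_sum = module_hom.sum[OF Vector_Spaces.linear.axioms(3)]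
lemmas linear_zero = module_hom.zero[OF Vector_Spaces.linear.axioms(3)]

lemma basis_inj: "inj_on e {1..n}"
  and basis_independent: "independent (e ` {1..n})"
  and basis_span: "span (e ` {1..n}) = UNIV"
  and basis_orthogonal: "\<lbrakk>i \<in> {1..n}; j \<in> {1..n}; i \<noteq> j\<rbrakk> \<Longrightarrow> mult (e i) (e j) = 0"
  using natural unfolding natural_basis_def by blast+

text \<open>
  This is a coordinate only for \<open>p \<in> {1..n}\<close>: for other \<open>p\<close> the vector \<open>e p\<close> is arbitrary and
  may coincide with one of the basis vectors.
\<close>

definition coord :: "'v \<Rightarrow> nat \<Rightarrow> 'k" where
  "coord x p = representation (e ` {1..n}) x (e p)"

lemma coord_add: "coord (x + y) p = coord x p + coord y p"
  unfolding coord_def by (rule representation_add[THEN fun_cong])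
    (simp_all only: basis_independent basis_span UNIV_I subset_UNIV finite_imageI
      finite_atLeastAtMost not_False_eq_True)

lemma coord_scale: "coord (scale c x) p = c * coord x p"
  unfolding coord_def by (rule representation_scale[THEN fun_cong])
    (simp_all only: basis_independent basis_span UNIV_I subset_UNIV finite_imageI
      finite_atLeastAtMost not_False_eq_True)

lemma coord_linear: "Vector_Spaces.linear scale (*) (\<lambda>x. coord x p)"
  by (unfold_locales) (auto simp: coord_add coord_scale algebra_simps)

lemma coord_zero [simp]: "coord 0 p = 0"
  by (rule linear_zero[OF coord_linear])

lemma coord_sum: "coord (sum f A) p = (\<Sum>q\<in>A. coord (f q) p)"
  by (rule linear_sum[OF coord_linear])

lemma coord_basis:
  assumes "p \<in> {1..n}" "q \<in> {1..n}"
  shows "coord (e p) q = (if p = q then 1 else 0)"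
  using assms inj_on_eq_iff[OF basis_inj assms]
  unfolding coord_def representation_basis[OF basis_independent imageI[OF assms(1)]] by auto

lemma coord_expansion: "x = (\<Sum>p=1..n. scale (coord x p) (e p))"
proof -
  have "x = (\<Sum>b\<in>e ` {1..n}. scale (representation (e ` {1..n}) x b) b)"
    by (rule sum_representation_eq[symmetric])
      (simp_all only: basis_independent basis_span UNIV_I subset_UNIV finite_imageI
      finite_atLeastAtMost not_False_eq_True)
  also have "\<dots> = (\<Sum>p=1..n. scale (coord x p) (e p))"
    using basis_inj by (simp add: sum.reindex coord_def)
  finally show ?thesis .
qed

lemma linear_coord_expansion:
  assumes "Vector_Spaces.linear scale scale f"
  shows "f x = (\<Sum>p=1..n. scale (coord x p) (f (e p)))"
  by (subst coord_expansion[of x]) (simp add: linear_sum[OF assms] linear_scale[OF assms])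

section \<open>Leading terms of products\<close>

lemma coord_span_higher:
  assumes "x \<in> span (e ` {m..n})" "1 \<le> q" "q < m" "q \<le> n"
  shows "coord x q = 0"
  using assms(1)
proof (induction rule: span_induct_alt)
  case base
  show ?case by simp
next
  case (step c y z)
  then show ?case using assms(2-4) by (auto simp: coord_add coord_scale coord_basis)
qed

lemma coord_square_low:
  assumes "1 \<le> q" "q \<le> p" "p \<le> n"
  shows "coord (mult (e p) (e p)) q = 0"
proof (cases "p = n")
  case True
  then show ?thesis by (simp add: square_last)
next
  case False
  have "coord (mult (e p) (e p)) q
      = coord (mult (e p) (e p) - e (Suc p)) q + coord (e (Suc p)) q"
    by (simp flip: coord_add)
  also have "\<dots> = 0"
    using assms False coord_span_higher[OF square_leading[of p], of q]
    by (simp add: coord_basis)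
  finally show ?thesis .
qed

lemma coord_square_leading:
  assumes "1 \<le> p" "p < n"
  shows "coord (mult (e p) (e p)) (Suc p) = 1"
proof -
  have "coord (mult (e p) (e p)) (Suc p)
      = coord (mult (e p) (e p) - e (Suc p)) (Suc p) + coord (e (Suc p)) (Suc p)"
    by (simp flip: coord_add)
  also have "\<dots> = 1"
    using assms coord_span_higher[OF square_leading[of p], of "Suc p"]
    by (simp add: coord_basis)
  finally show ?thesis .
qed

lemma mult_basis_right:
  assumes "j \<in> {1..n}"
  shows "mult x (e j) = scale (coord x j) (mult (e j) (e j))"
proof -
  have "mult x (e j) = (\<Sum>p=1..n. scale (coord x p) (mult (e p) (e j)))"
    by (rule linear_coord_expansion[OF linear_left])
  also have "\<dots> = (\<Sum>p=1..n. if p = j then scale (coord x j) (mult (e j) (e j)) else 0)"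
    using assms by (intro sum.cong) (auto simp: basis_orthogonal)
  finally show ?thesis using assms by simp
qed

lemma mult_basis_left:
  assumes "j \<in> {1..n}"
  shows "mult (e j) x = scale (coord x j) (mult (e j) (e j))"
proof -
  have "mult (e j) x = (\<Sum>p=1..n. scale (coord x p) (mult (e j) (e p)))"
    by (rule linear_coord_expansion[OF linear_right])
  also have "\<dots> = (\<Sum>p=1..n. if p = j then scale (coord x j) (mult (e j) (e j)) else 0)"
    using assms by (intro sum.cong) (auto simp: basis_orthogonal)
  finally show ?thesis using assms by simp
qed

lemma mult_expansion:
  "mult x y = (\<Sum>p=1..n. scale (coord x p * coord y p) (mult (e p) (e p)))"
proof -
  have "mult x y = (\<Sum>p=1..n. scale (coord y p) (mult x (e p)))"
    by (rule linear_coord_expansion[OF linear_right])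
  also have "\<dots> = (\<Sum>p=1..n. scale (coord x p * coord y p) (mult (e p) (e p)))"
    by (intro sum.cong refl, subst mult_basis_right) (simp_all add: mult.commute)
  finally show ?thesis .
qed

text \<open>
  If all earlier products of coordinates vanish, then the product starts with a multiple of \<open>e\<^sub>p\<^sup>2\<close>,
  whose leading term is \<open>e\<^sub>p\<^sub>+\<^sub>1\<close>.
\<close>

lemma coord_mult_leading:
  assumes "1 \<le> p" "p < n" and low: "\<And>q. \<lbrakk>1 \<le> q; q < p\<rbrakk> \<Longrightarrow> coord x q * coord y q = 0"
  shows "coord (mult x y) (Suc p) = coord x p * coord y p"
proof -
  have "coord (mult x y) (Suc p)
      = (\<Sum>q=1..n. coord x q * coord y q * coord (mult (e q) (e q)) (Suc p))"
    by (subst mult_expansion) (simp add: coord_sum coord_scale)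
  also have "\<dots> = (\<Sum>q=1..n. if q = p then coord x p * coord y p else 0)"
  proof (rule sum.cong[OF refl])
    fix q assume "q \<in> {1..n}"
    then consider "1 \<le> q" "q < p" | "q = p" | "Suc p \<le> q" "q \<le> n"
      by fastforce
    then show "coord x q * coord y q * coord (mult (e q) (e q)) (Suc p)
        = (if q = p then coord x p * coord y p else 0)"
      by cases (use assms in \<open>simp_all add: low coord_square_leading coord_square_low\<close>)
  qed
  also have "\<dots> = coord x p * coord y p"
    using assms by simp
  finally show ?thesis .
qed

lemma coord_products_zero:
  assumes m: "m \<le> n" and zero: "\<And>q. \<lbrakk>1 \<le> q; q \<le> m\<rbrakk> \<Longrightarrow> coord (mult x y) q = 0"
    and "1 \<le> p" "p < m"
  shows "coord x p * coord y p = 0"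
  using assms(3,4)
proof (induction p rule: less_induct)
  case (less p)
  then have "coord (mult x y) (Suc p) = coord x p * coord y p"
    using m by (intro coord_mult_leading) auto
  then show ?case using zero[of "Suc p"] less.prems by simp
qed

section \<open>Derivations and endomorphisms on squares\<close>

text \<open>
  The two summands of \<open>D(e\<^sub>i\<^sup>2) = D(e\<^sub>i) e\<^sub>i + e\<^sub>i D(e\<^sub>i)\<close> only involve the \<open>i\<close>-th coordinate of
  \<open>D(e\<^sub>i)\<close>, because \<open>e\<^sub>i\<close> annihilates the other basis vectors.
\<close>

lemma derivation_square:
  assumes "D \<in> Der scale mult" "i \<in> {1..n}"
  shows "D (mult (e i) (e i)) = scale (2 * coord (D (e i)) i) (mult (e i) (e i))"
proof -
  have "D (mult (e i) (e i)) = mult (D (e i)) (e i) + mult (e i) (D (e i))"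
    using assms(1) unfolding Der_def by blast
  also have "\<dots> = scale (coord (D (e i)) i) (mult (e i) (e i))
      + scale (coord (D (e i)) i) (mult (e i) (e i))"
    by (rule arg_cong2[OF mult_basis_right[OF assms(2)] mult_basis_left[OF assms(2)]])
  also have "\<dots> = scale (2 * coord (D (e i)) i) (mult (e i) (e i))"
    by (simp only: mult_2 scale_left_distrib)
  finally show ?thesis .
qed

context
  fixes \<phi> :: "'v \<Rightarrow> 'v"
  assumes \<phi>_linear: "Vector_Spaces.linear scale scale \<phi>"
    and \<phi>_mult: "\<And>x y. \<phi> (mult x y) = mult (\<phi> x) (\<phi> y)"
begin

lemma coord_endomorphism:
  "coord (\<phi> x) p = (\<Sum>q=1..n. coord x q * coord (\<phi> (e q)) p)"
  by (subst linear_coord_expansion[OF \<phi>_linear]) (simp add: coord_sum coord_scale)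

text \<open>
  Suppose that \<open>\<phi>\<close> maps each \<open>e\<^sub>j\<close> with \<open>j > i\<close> into the span of \<open>e\<^sub>j, \<dots>, e\<^sub>n\<close>. Then
  \<open>\<phi>(e\<^sub>i)\<^sup>2 = \<phi>(e\<^sub>i\<^sup>2)\<close> only involves \<open>e\<^sub>i\<^sub>+\<^sub>1, \<dots>, e\<^sub>n\<close>; as squaring moves the leading index
  of a vector up by one, \<open>\<phi>(e\<^sub>i)\<close> cannot start before \<open>e\<^sub>i\<close>.
\<close>

lemma endomorphism_triangular:
  assumes "1 \<le> p" "p < i" "i \<le> n"
  shows "coord (\<phi> (e i)) p = 0"
  using assms
proof (induction "n - i" arbitrary: i p rule: less_induct)
  case less
  have "coord (mult (\<phi> (e i)) (\<phi> (e i))) q = 0" if q: "1 \<le> q" "q \<le> i" for q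
  proof -
    have "coord (\<phi> (mult (e i) (e i))) q
        = (\<Sum>j=1..n. coord (mult (e i) (e i)) j * coord (\<phi> (e j)) q)"
      by (rule coord_endomorphism)
    also have "\<dots> = 0"
    proof (rule sum.neutral, rule ballI)
      fix j assume j: "j \<in> {1..n}"
      show "coord (mult (e i) (e i)) j * coord (\<phi> (e j)) q = 0"
      proof (cases "j \<le> i")
        case True
        then show ?thesis using j less.prems by (simp add: coord_square_low)
      next
        case False
        then have "coord (\<phi> (e j)) q = 0"
          using j q less.prems by (intro less.hyps) auto
        then show ?thesis by simp
      qed
    qed
    finally show ?thesis by (simp add: \<phi>_mult)
  qed
  then have "coord (\<phi> (e i)) p * coord (\<phi> (e i)) p = 0"
    using less.prems by (intro coord_products_zero[of i]) auto
  then show ?case by simp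
qed

text \<open>
  Comparing the coefficients of \<open>e\<^sub>i\<^sub>+\<^sub>1\<close> in \<open>\<phi>(e\<^sub>i\<^sup>2) = \<phi>(e\<^sub>i)\<^sup>2\<close> shows that each diagonal entry is the
  square of the previous one, so all of them are nonzero once the last one is.
\<close>

lemma endomorphism_diagonal:
  assumes last: "\<phi> (e n) \<noteq> 0" and "1 \<le> i" "i \<le> n"
  shows "coord (\<phi> (e i)) i \<noteq> 0"
  using assms(3,2)
proof (induction i rule: inc_induct)
  case base
  show ?case
  proof
    assume "coord (\<phi> (e n)) n = 0"
    then have "coord (\<phi> (e n)) p = 0" if "p \<in> {1..n}" for p
      using that endomorphism_triangular[of p n] by (cases "p = n") auto
    then have "\<phi> (e n) = (\<Sum>p=1..n. scale 0 (e p))"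
      by (subst coord_expansion) (intro sum.cong, simp_all)
    then show False
      using last by simp
  qed
next
  case (step i)
  have "coord (\<phi> (mult (e i) (e i))) (Suc i)
      = (\<Sum>j=1..n. coord (mult (e i) (e i)) j * coord (\<phi> (e j)) (Suc i))"
    by (rule coord_endomorphism)
  also have "\<dots> = (\<Sum>j=1..n. if j = Suc i then coord (\<phi> (e (Suc i))) (Suc i) else 0)"
  proof (rule sum.cong[OF refl])
    fix j assume "j \<in> {1..n}"
    then consider "1 \<le> j" "j \<le> i" | "j = Suc i" | "Suc i < j" "j \<le> n"
      by fastforce
    then show "coord (mult (e i) (e i)) j * coord (\<phi> (e j)) (Suc i)
        = (if j = Suc i then coord (\<phi> (e (Suc i))) (Suc i) else 0)"
      by cases (use step in \<open>simp_all add: coord_square_low coord_square_leading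
          endomorphism_triangular\<close>)
  qed
  also have "\<dots> = coord (\<phi> (e (Suc i))) (Suc i)"
    using step by simp
  finally have "coord (\<phi> (e (Suc i))) (Suc i)
      = coord (mult (\<phi> (e i)) (\<phi> (e i))) (Suc i)"
    by (simp add: \<phi>_mult)
  also have "\<dots> = coord (\<phi> (e i)) i * coord (\<phi> (e i)) i"
    using step by (intro coord_mult_leading) (auto simp: endomorphism_triangular)
  finally show ?case
    using step by auto
qed

lemma endomorphism_off_diagonal:
  assumes last: "\<phi> (e n) \<noteq> 0" and "i \<in> {1..n}" "1 \<le> j" "j < n" "j \<noteq> i"
  shows "coord (\<phi> (e i)) j = 0"
proof (cases "j < i")
  case True
  then show ?thesis using assms by (intro endomorphism_triangular) auto
next
  case False
  have "mult (\<phi> (e i)) (\<phi> (e j)) = 0"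
    using assms by (simp flip: \<phi>_mult add: basis_orthogonal linear_zero[OF \<phi>_linear])
  then have "coord (\<phi> (e i)) j * coord (\<phi> (e j)) j = 0"
    using assms by (intro coord_products_zero[of n]) auto
  then show ?thesis
    using endomorphism_diagonal[OF last, of j] assms by simp
qed

lemma endomorphism_square:
  assumes last: "\<phi> (e n) \<noteq> 0" and "i \<in> {1..n}"
  shows "\<phi> (mult (e i) (e i)) = scale ((coord (\<phi> (e i)) i)\<^sup>2) (mult (e i) (e i))"
proof -
  have "\<phi> (mult (e i) (e i))
      = (\<Sum>p=1..n. scale (coord (\<phi> (e i)) p * coord (\<phi> (e i)) p) (mult (e p) (e p)))"
    unfolding \<phi>_mult by (rule mult_expansion)
  also have "\<dots> = (\<Sum>p=1..n. if p = i
      then scale ((coord (\<phi> (e i)) i)\<^sup>2) (mult (e i) (e i)) else 0)"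
  proof (rule sum.cong[OF refl])
    fix p assume "p \<in> {1..n}"
    then consider "p = i" | "p = n" "p \<noteq> i" | "p \<noteq> i" "1 \<le> p" "p < n"
      by fastforce
    then show "scale (coord (\<phi> (e i)) p * coord (\<phi> (e i)) p) (mult (e p) (e p))
        = (if p = i then scale ((coord (\<phi> (e i)) i)\<^sup>2) (mult (e i) (e i)) else 0)"
      by cases (use assms in \<open>simp_all add: power2_eq_square square_last
          endomorphism_off_diagonal\<close>)
  qed
  finally show ?thesis using assms by simp
qed

end

lemma automorphism_square:
  assumes "\<phi> \<in> Aut scale mult" "i \<in> {1..n}"
  shows "\<exists>c. \<phi> (mult (e i) (e i)) = scale c (mult (e i) (e i))"
proof -
  have lin: "Vector_Spaces.linear scale scale \<phi>" and inj: "inj \<phi>"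
    and hom: "\<phi> (mult x y) = mult (\<phi> x) (\<phi> y)" for x y
    using assms(1) by (auto simp: Aut_def bij_def)
  have "e n \<noteq> 0"
    using coord_basis[of n n] n_pos by auto
  then have "\<phi> (e n) \<noteq> 0"
    using injD[OF inj, of "e n" 0] linear_zero[OF lin] by auto
  from endomorphism_square[OF lin hom this assms(2)] show ?thesis ..
qed

section \<open>Commutators\<close>

lemma commutator_common_eigenvector:
  assumes "Vector_Spaces.linear scale scale S" "Vector_Spaces.linear scale scale T"
    and "S x = scale s x" "T x = scale t x"
  shows "commutator S T x = 0"
  unfolding commutator_def
  by (simp add: assms(3,4) linear_scale[OF assms(1)] linear_scale[OF assms(2)] mult.commute)

lemma commutator_eq_zero_iff:
  assumes S: "Vector_Spaces.linear scale scale S" and T: "Vector_Spaces.linear scale scale T"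
    and tail: "\<And>i. \<lbrakk>k < i; i \<le> n\<rbrakk> \<Longrightarrow> commutator S T (e i) = 0"
  shows "commutator S T = (\<lambda>x. 0) \<longleftrightarrow> (\<forall>i\<in>{1..k}. commutator S T (e i) = 0)"
proof
  assume low: "\<forall>i\<in>{1..k}. commutator S T (e i) = 0"
  have comm: "S (T (e i)) = T (S (e i))" if "i \<in> {1..n}" for i
    using low tail[of i] that by (cases "i \<le> k") (auto simp: commutator_def)
  have "S (T x) = T (S x)" for x
  proof -
    have "S (T x) = (\<Sum>p=1..n. scale (coord x p) (S (T (e p))))"
      by (subst linear_coord_expansion[OF T])
        (simp add: linear_sum[OF S] linear_scale[OF S])
    also have "\<dots> = (\<Sum>p=1..n. scale (coord x p) (T (S (e p))))"
      by (simp add: comm)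
    also have "\<dots> = T (S x)"
      by (subst (2) linear_coord_expansion[OF S])
        (simp add: linear_sum[OF T] linear_scale[OF T])
    finally show ?thesis .
  qed
  then show "commutator S T = (\<lambda>x. 0)"
    by (simp add: commutator_def)
qed simp

end

section \<open>The normal form above its last nonzero structure constant\<close>

lemma above_i0_entry_zero:
  assumes "i0 n a < i" "1 \<le> i" "i + 1 < j" "j < n"
  shows "a i j = 0"
proof (rule ccontr)
  assume "a i j \<noteq> 0"
  then have mem: "(i, j) \<in> index_set n a"
    using assms by (simp add: index_set_def)
  have "finite {i. \<exists>j. (i, j) \<in> index_set n a}"
    by (rule finite_subset[of _ "{..n}"]) (auto simp: index_set_def)
  then have "i \<le> Max {i. \<exists>j. (i, j) \<in> index_set n a}"
    using mem by (intro Max_ge) auto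
  then show False
    using assms(1) mem by (auto simp: i0_def split: if_splits)
qed

text \<open>
  The separate equations for \<open>i = n - 2\<close> and \<open>i = n - 1\<close> are instances of the general one, with
  an empty sum.
\<close>

lemma normal_form_square:
  assumes "normal_form scale mult n e a" "1 \<le> i" "i < n"
  shows "mult (e i) (e i) = e (Suc i) + (\<Sum>j\<in>{i+2..n-1}. scale (a i j) (e j))"
proof -
  from assms(2,3) consider "i \<in> {1..n-3}" | "i = n - 2" "n - 2 \<ge> 1" | "i = n - 1"
    by fastforce
  then show ?thesis
  proof cases
    case 2
    then have "Suc i = n - 1" "{i+2..n-1} = {}" by auto
    with 2 show ?thesis using assms(1) by (simp add: normal_form_def)
  next
    case 3
    then have "Suc i = n" "{i+2..n-1} = {}" using assms by auto
    with 3 show ?thesis using assms(1) by (simp add: normal_form_def)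
  qed (use assms(1) in \<open>auto simp: normal_form_def\<close>)
qed

lemma normal_form_square_above_i0:
  assumes "vector_space scale" "normal_form scale mult n e a" "i0 n a < i" "i < n"
  shows "mult (e i) (e i) = e (Suc i)"
proof -
  interpret vector_space scale by fact
  have "(\<Sum>j\<in>{i+2..n-1}. scale (a i j) (e j)) = 0"
    using assms(3,4) by (intro sum.neutral) (auto simp: above_i0_entry_zero)
  then show ?thesis
    using normal_form_square[OF assms(2), of i] assms(3,4) by simp
qed

lemma normal_form_chain_evolution_algebra:
  assumes "1 \<le> n" "algebra_over scale mult" "normal_form scale mult n e a"
  shows "chain_evolution_algebra scale mult n e"
proof -
  interpret vector_space scale
    using assms(2) by (simp add: algebra_over_def)
  show ?thesis
  proof (intro chain_evolution_algebra.intro chain_evolution_algebra_axioms.intro)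
    fix i assume i: "1 \<le> i" "i < n"
    have "(\<Sum>j\<in>{i+2..n-1}. scale (a i j) (e j)) \<in> span (e ` {i+2..n})"
      by (intro span_sum span_scale span_base) auto
    then show "mult (e i) (e i) - e (Suc i) \<in> span (e ` {i+2..n})"
      by (simp add: normal_form_square[OF assms(3) i])
  qed (use assms in \<open>simp_all add: algebra_over_def normal_form_def\<close>)
qed

theorem proposition6p8:
  fixes scale :: "'k::field_char_0 \<Rightarrow> 'v::ab_group_add \<Rightarrow> 'v"
    and mult :: "'v \<Rightarrow> 'v \<Rightarrow> 'v"
    and n k :: nat
    and e :: "nat \<Rightarrow> 'v"
    and a :: "nat \<Rightarrow> nat \<Rightarrow> 'k"
    and R :: "'v \<Rightarrow> 'v"
  assumes "n \<ge> 3"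
    and "nilpotent_evolution_algebra_max_nilindex scale mult n"
    and "normal_form scale mult n e a"
    and "R \<in> RB0 scale mult"
    and "nonzero_threshold scale n e a R k"
  shows
    "(\<forall>i\<in>{k+1..n-1}. \<forall>D\<in>Der scale mult. \<forall>\<phi>\<in>Aut scale mult.
        commutator R D (e i) = 0 \<and> commutator R \<phi> (e i) = 0) \<and>
     (\<forall>D\<in>Der scale mult.
        commutator R D = (\<lambda>x. 0) \<longleftrightarrow> (\<forall>i\<in>{1..k}. commutator R D (e i) = 0)) \<and>
     (\<forall>\<phi>\<in>Aut scale mult.
        commutator R \<phi> = (\<lambda>x. 0) \<longleftrightarrow> (\<forall>i\<in>{1..k}. commutator R \<phi> (e i) = 0))"
proof -
  have alg: "algebra_over scale mult"
    using assms(2) by (simp add: nilpotent_evolution_algebra_max_nilindex_def evolution_algebra_def)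
  interpret chain_evolution_algebra scale mult n e
    using assms(1) by (intro normal_form_chain_evolution_algebra[OF _ alg assms(3)]) simp
  have R: "Vector_Spaces.linear scale scale R"
    using assms(4) by (simp add: RB0_def)
  have k: "i0 n a < k"
    using assms(5) by (simp add: nonzero_threshold_def)
  have R_tail: "\<exists>c. R (e i) = scale c (e i)" if "k < i" "i \<le> n" for i
    using assms(5) that by (auto simp: nonzero_threshold_def)
  have tail_square: "\<exists>j\<in>{1..n}. e i = mult (e j) (e j)" if "k < i" "i \<le> n" for i
    using normal_form_square_above_i0[OF vector_space_axioms assms(3), of "i - 1"] k that
    by (intro bexI[of _ "i - 1"]) auto
  have D_tail: "commutator R D (e i) = 0"
    if "D \<in> Der scale mult" "k < i" "i \<le> n" for D i
  proof -
    have "Vector_Spaces.linear scale scale D"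
      using that(1) by (simp add: Der_def)
    moreover have "\<exists>c. D (e i) = scale c (e i)"
      using tail_square[OF that(2,3)] derivation_square[OF that(1)] by metis
    ultimately show ?thesis
      using commutator_common_eigenvector[OF R] R_tail[OF that(2,3)] by blast
  qed
  have \<phi>_tail: "commutator R \<phi> (e i) = 0"
    if "\<phi> \<in> Aut scale mult" "k < i" "i \<le> n" for \<phi> i
  proof -
    have "Vector_Spaces.linear scale scale \<phi>"
      using that(1) by (simp add: Aut_def)
    moreover have "\<exists>c. \<phi> (e i) = scale c (e i)"
      using tail_square[OF that(2,3)] automorphism_square[OF that(1)] by metis
    ultimately show ?thesis
      using commutator_common_eigenvector[OF R] R_tail[OF that(2,3)] by blast
  qed
  show ?thesis
  proof (intro conjI ballI)
    fix D assume D: "D \<in> Der scale mult"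
    then show "commutator R D = (\<lambda>x. 0) \<longleftrightarrow> (\<forall>i\<in>{1..k}. commutator R D (e i) = 0)"
      by (intro commutator_eq_zero_iff[OF R] D_tail) (simp_all add: Der_def)
  next
    fix \<phi> assume \<phi>: "\<phi> \<in> Aut scale mult"
    then show "commutator R \<phi> = (\<lambda>x. 0) \<longleftrightarrow> (\<forall>i\<in>{1..k}. commutator R \<phi> (e i) = 0)"
      by (intro commutator_eq_zero_iff[OF R] \<phi>_tail) (simp_all add: Aut_def)
  qed (auto intro: D_tail \<phi>_tail)
qed

end
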